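(* Let $X$ be a non-empty Lindelöf locally compact Hausdorff space, let $\mathcal{I}$ be a Riesz ideal of $C(X)$ and $(g_n)_{n\in\mathbb{N}}$ a sequence in $\mathcal{I}$. Then the following are equivalent: (1) The sequence $(g_n)_{n\in\mathbb{N}}$ is a strict $\mathcal{I}$-Cauchy sequence. (2) There exists an element $b\in\mathcal{I}^+$ such that $|g_n|\le b$ holds for all $n\in\mathbb{N}$, and $(g_n)_{n\in\mathbb{N}}$ is a Cauchy sequence with respect to the locally convex topology of uniform convergence on all compact subsets of $X$. If one, hence both, of these statements are true, then the sequence $(g_n)_{n\in\mathbb{N}}$ converges to a limit $\hat g\in\mathcal{I}$ in the locally convex topology of uniform convergence on all compact subsets of $X$, and is also strictly $\mathcal{I}$-convergent with strict $\mathcal{I}$-limit $\hat g$.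
   Context: $\mathbb{N}=\{1,2,3,\dots\}$. $C(X)$ is the space of real-valued continuous functions on $X$ with pointwise operations and pointwise order; $|f|$ is the pointwise absolute value. A Riesz ideal of $C(X)$ is a linear subspace $\mathcal{I}\subseteq C(X)$ such that $f\in C(X)$, $g\in\mathcal{I}$ and $|f|\le|g|$ imply $f\in\mathcal{I}$; $\mathcal{I}^+$ denotes the set of functions in $\mathcal{I}$ that are $\ge 0$. A decreasing sequence $(f_k)_{k\in\mathbb{N}}$ in $\mathcal{I}$ has pointwise infimum $0$ if $\inf_{k} f_k(x)=0$ for all $x\in X$. A sequence $(g_n)_{n\in\mathbb{N}}$ in $\mathcal{I}$ is strictly $\mathcal{I}$-convergent to $\hat g\in\mathcal{I}$ (its strict $\mathcal{I}$-limit) if there exists a decreasing sequence $(f_k)_{k\in\mathbb{N}}$ in $\mathcal{I}$ with pointwise infimum $0$ such that for all $k\in\mathbb{N}$ there is $N\in\mathbb{N}$ with $|\hat g-g_n|\le f_k$ for all $n\ge N$. It is a strict $\mathcal{I}$-Cauchy sequence if there exists a decreasing sequence $(f_k)_{k\in\mathbb{N}}$ in $\mathcal{I}$ with pointwise infimum $0$ such that for all $k\in\mathbb{N}$ there is $N\in\mathbb{N}$ with $|g_n-g_N|\le f_k$ for all $n\ge N$. *)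

theory Defs
  imports "HOL-Analysis.Analysis"
begin

text \<open>
  Functions on a space \<open>X\<close> are functions on the underlying type that are undefined outside
  \<open>topspace X\<close>, so that equality in HOL is equality as functions on \<open>X\<close>.
\<close>

definition cont_funs :: "'a topology \<Rightarrow> ('a \<Rightarrow> real) set" where
  "cont_funs X = {f \<in> extensional (topspace X). continuous_map X euclideanreal f}"

definition fun_le :: "'a topology \<Rightarrow> ('a \<Rightarrow> real) \<Rightarrow> ('a \<Rightarrow> real) \<Rightarrow> bool" where
  "fun_le X f g \<longleftrightarrow> (\<forall>x\<in>topspace X. f x \<le> g x)"

definition fun_zero :: "'a topology \<Rightarrow> 'a \<Rightarrow> real" where
  "fun_zero X = (\<lambda>x\<in>topspace X. 0)"

definition fun_add :: "'a topology \<Rightarrow> ('a \<Rightarrow> real) \<Rightarrow> ('a \<Rightarrow> real) \<Rightarrow> 'a \<Rightarrow> real" where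
  "fun_add X f g = (\<lambda>x\<in>topspace X. f x + g x)"

definition fun_diff :: "'a topology \<Rightarrow> ('a \<Rightarrow> real) \<Rightarrow> ('a \<Rightarrow> real) \<Rightarrow> 'a \<Rightarrow> real" where
  "fun_diff X f g = (\<lambda>x\<in>topspace X. f x - g x)"

definition fun_scale :: "'a topology \<Rightarrow> real \<Rightarrow> ('a \<Rightarrow> real) \<Rightarrow> 'a \<Rightarrow> real" where
  "fun_scale X c f = (\<lambda>x\<in>topspace X. c * f x)"

definition fun_abs :: "'a topology \<Rightarrow> ('a \<Rightarrow> real) \<Rightarrow> 'a \<Rightarrow> real" where
  "fun_abs X f = (\<lambda>x\<in>topspace X. \<bar>f x\<bar>)"

definition riesz_ideal :: "'a topology \<Rightarrow> ('a \<Rightarrow> real) set \<Rightarrow> bool" where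
  "riesz_ideal X I \<longleftrightarrow>
     I \<subseteq> cont_funs X \<and>
     fun_zero X \<in> I \<and>
     (\<forall>f\<in>I. \<forall>g\<in>I. fun_add X f g \<in> I) \<and>
     (\<forall>c. \<forall>f\<in>I. fun_scale X c f \<in> I) \<and>
     (\<forall>f\<in>cont_funs X. \<forall>g\<in>I. fun_le X (fun_abs X f) (fun_abs X g) \<longrightarrow> f \<in> I)"

definition positive_part :: "'a topology \<Rightarrow> ('a \<Rightarrow> real) set \<Rightarrow> ('a \<Rightarrow> real) set" where
  "positive_part X I = {f \<in> I. fun_le X (fun_zero X) f}"

definition decreasing_in :: "'a topology \<Rightarrow> ('a \<Rightarrow> real) set \<Rightarrow> (nat \<Rightarrow> 'a \<Rightarrow> real) \<Rightarrow> bool" where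
  "decreasing_in X I f \<longleftrightarrow> (\<forall>k. f k \<in> I) \<and> (\<forall>j k. j \<le> k \<longrightarrow> fun_le X (f k) (f j))"

text \<open>
  The infimum of a set of reals that is not bounded below is an unspecified real in HOL,
  hence the explicit boundedness condition.
\<close>

definition pointwise_inf_zero :: "'a topology \<Rightarrow> (nat \<Rightarrow> 'a \<Rightarrow> real) \<Rightarrow> bool" where
  "pointwise_inf_zero X f \<longleftrightarrow>
     (\<forall>x\<in>topspace X. bdd_below (range (\<lambda>k. f k x)) \<and> (INF k. f k x) = 0)"

definition strictly_convergent ::
  "'a topology \<Rightarrow> ('a \<Rightarrow> real) set \<Rightarrow> (nat \<Rightarrow> 'a \<Rightarrow> real) \<Rightarrow> ('a \<Rightarrow> real) \<Rightarrow> bool" where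
  "strictly_convergent X I g h \<longleftrightarrow>
     (\<forall>n. g n \<in> I) \<and> h \<in> I \<and>
     (\<exists>f. decreasing_in X I f \<and> pointwise_inf_zero X f \<and>
       (\<forall>k. \<exists>N. \<forall>n\<ge>N. fun_le X (fun_abs X (fun_diff X h (g n))) (f k)))"

definition strictly_Cauchy ::
  "'a topology \<Rightarrow> ('a \<Rightarrow> real) set \<Rightarrow> (nat \<Rightarrow> 'a \<Rightarrow> real) \<Rightarrow> bool" where
  "strictly_Cauchy X I g \<longleftrightarrow>
     (\<forall>n. g n \<in> I) \<and>
     (\<exists>f. decreasing_in X I f \<and> pointwise_inf_zero X f \<and>
       (\<forall>k. \<exists>N. \<forall>n\<ge>N. fun_le X (fun_abs X (fun_diff X (g n) (g N))) (f k)))"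

text \<open>
  The locally convex topology of uniform convergence on compact subsets: the sets
  \<open>ucc_ball X K e f\<close> with \<open>K\<close> compact and \<open>e > 0\<close> form a neighbourhood base at \<open>f\<close>.
  Finite unions of compact sets being compact, finitely many seminorms need not be combined.
\<close>

definition ucc_ball :: "'a topology \<Rightarrow> 'a set \<Rightarrow> real \<Rightarrow> ('a \<Rightarrow> real) \<Rightarrow> ('a \<Rightarrow> real) set" where
  "ucc_ball X K e f = {h \<in> cont_funs X. \<forall>x\<in>K. \<bar>h x - f x\<bar> < e}"

definition ucc_open :: "'a topology \<Rightarrow> ('a \<Rightarrow> real) set \<Rightarrow> bool" where
  "ucc_open X U \<longleftrightarrow>
     U \<subseteq> cont_funs X \<and> (\<forall>f\<in>U. \<exists>K e. compactin X K \<and> e > 0 \<and> ucc_ball X K e f \<subseteq> U)"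

definition ucc_topology :: "'a topology \<Rightarrow> ('a \<Rightarrow> real) topology" where
  "ucc_topology X = topology (ucc_open X)"

lemma istopology_ucc_open: "istopology (ucc_open X)"
  unfolding istopology_def
proof (intro conjI allI impI)
  fix S T
  assume S: "ucc_open X S" and T: "ucc_open X T"
  show "ucc_open X (S \<inter> T)"
    unfolding ucc_open_def
  proof (intro conjI ballI)
    show "S \<inter> T \<subseteq> cont_funs X"
      using S by (auto simp: ucc_open_def)
    fix f assume f: "f \<in> S \<inter> T"
    obtain K d where K: "compactin X K" "d > 0" "ucc_ball X K d f \<subseteq> S"
      using S f unfolding ucc_open_def by blast
    obtain L e where L: "compactin X L" "e > 0" "ucc_ball X L e f \<subseteq> T"
      using T f unfolding ucc_open_def by blast
    have "ucc_ball X (K \<union> L) (min d e) f \<subseteq> ucc_ball X K d f \<inter> ucc_ball X L e f"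
      by (auto simp: ucc_ball_def)
    with K L show "\<exists>M r. compactin X M \<and> r > 0 \<and> ucc_ball X M r f \<subseteq> S \<inter> T"
      by (intro exI[of _ "K \<union> L"] exI[of _ "min d e"]) (auto simp: compactin_Un)
  qed
next
  fix \<U> assume "\<forall>U\<in>\<U>. ucc_open X U"
  then show "ucc_open X (\<Union>\<U>)"
    unfolding ucc_open_def by (meson Sup_le_iff Sup_upper UnionE order_trans)
qed

lemma openin_ucc_topology: "openin (ucc_topology X) = ucc_open X"
  by (simp add: ucc_topology_def topology_inverse' istopology_ucc_open)

lemma topspace_ucc_topology: "topspace (ucc_topology X) = cont_funs X"
proof -
  have "ucc_open X (cont_funs X)"
    unfolding ucc_open_def ucc_ball_def
    by (auto intro!: exI[of _ "{}"] exI[of _ "1::real"])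
  then show ?thesis
    unfolding topspace_def openin_ucc_topology by (auto simp: ucc_open_def)
qed

text \<open>Cauchy sequences in the sense of topological vector spaces.\<close>

definition ucc_Cauchy :: "'a topology \<Rightarrow> (nat \<Rightarrow> 'a \<Rightarrow> real) \<Rightarrow> bool" where
  "ucc_Cauchy X g \<longleftrightarrow>
     (\<forall>n. g n \<in> cont_funs X) \<and>
     (\<forall>U. openin (ucc_topology X) U \<and> fun_zero X \<in> U \<longrightarrow>
        (\<exists>N. \<forall>m\<ge>N. \<forall>n\<ge>N. fun_diff X (g m) (g n) \<in> U))"

end

theory Submission imports Defs begin

text \<open>
  Uniform convergence on compact sets enters only through its two elementary faces: the Cauchy
  property in the topological vector space of continuous functions means that \<open>g m - g n\<close> is
  uniformly small on every compact set (\<open>ucc_Cauchy_iff_uniformly_Cauchy\<close>), and so on a whole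
  neighbourhood of each point of a locally compact space.

  From strict Cauchyness to uniform convergence the step is Dini's theorem
  (\<open>Dini_compactin\<close>): a decreasing sequence of continuous functions with pointwise infimum
  zero tends to zero uniformly on compact sets, and its members dominate the differences
  \<open>g n - g N\<close>.  The order bound is a finite sum of some \<open>\<bar>g n\<bar>\<close> plus the first
  dominating function.

  Conversely, suppose that \<open>\<bar>g n\<bar> \<le> b\<close> and that \<open>g\<close> is Cauchy.  The pointwise
  limit \<open>h\<close> satisfies \<open>\<bar>h\<bar> \<le> b\<close>, and the natural candidates for the dominating
  sequence are the tail suprema \<open>p n = sup {\<bar>h - g m\<bar> | m \<ge> n}\<close>.  They decrease
  pointwise to zero and are at most \<open>2 b\<close>, so all that is at stake is continuity of \<open>h\<close>
  and of \<open>p n\<close>; the ideal property then puts these functions into \<open>I\<close>.  An infinite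
  supremum of continuous functions need not be continuous, but here the family \<open>g\<close> is
  equicontinuous (\<open>locally_uniformly_Cauchy_equicontinuous\<close>), and equicontinuity passes to
  pointwise limits and to pointwise suprema.  The same functions, doubled, witness that \<open>g\<close>
  is strictly Cauchy, because \<open>\<bar>g n - g N\<bar> \<le> \<bar>h - g n\<bar> + \<bar>h - g N\<bar>\<close>.
\<close>

section \<open>Continuity and equicontinuity\<close>

lemma continuous_map_real_iff:
  "continuous_map X euclideanreal f \<longleftrightarrow>
     (\<forall>x\<in>topspace X. \<forall>e>0. \<exists>U. openin X U \<and> x \<in> U \<and> (\<forall>y\<in>U. \<bar>f y - f x\<bar> < e))"
  using Met_TC.continuous_map_to_metric[of X f]
  by (simp add: dist_real_def abs_minus_commute)

definition equicontinuous :: "'a topology \<Rightarrow> ('i \<Rightarrow> 'a \<Rightarrow> real) \<Rightarrow> bool" where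
  "equicontinuous X g \<longleftrightarrow>
     (\<forall>x\<in>topspace X. \<forall>e>0. \<exists>U. openin X U \<and> x \<in> U \<and> (\<forall>i. \<forall>y\<in>U. \<bar>g i y - g i x\<bar> \<le> e))"

text \<open>
  Near \<open>x\<close> all late members of the sequence are uniformly close to one fixed member, whose
  continuity therefore serves them all; the early members are finite in number.
\<close>

lemma locally_uniformly_Cauchy_equicontinuous:
  fixes g :: "nat \<Rightarrow> 'a \<Rightarrow> real"
  assumes cont: "\<And>n. continuous_map X euclideanreal (g n)"
    and Cauchy: "\<And>x. x \<in> topspace X \<Longrightarrow> \<exists>U. openin X U \<and> x \<in> U \<and>
      (\<forall>e>0. \<exists>N. \<forall>m\<ge>N. \<forall>n\<ge>N. \<forall>y\<in>U. \<bar>g m y - g n y\<bar> < e)"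
  shows "equicontinuous X g"
  unfolding equicontinuous_def
proof (intro ballI allI impI)
  fix x and e :: real
  assume x: "x \<in> topspace X" and e: "e > 0"
  obtain U where U: "openin X U" "x \<in> U"
    and "\<forall>e>0. \<exists>N. \<forall>m\<ge>N. \<forall>n\<ge>N. \<forall>y\<in>U. \<bar>g m y - g n y\<bar> < e"
    using Cauchy[OF x] by blast
  then obtain N where N: "\<And>m n y. \<lbrakk>m \<ge> N; n \<ge> N; y \<in> U\<rbrakk> \<Longrightarrow> \<bar>g m y - g n y\<bar> < e / 3"
    using e by (meson divide_pos_pos zero_less_numeral)
  have "\<exists>W. openin X W \<and> x \<in> W \<and> (\<forall>y\<in>W. \<bar>g i y - g i x\<bar> < e / 3)" for i
    using cont[of i, unfolded continuous_map_real_iff, rule_format, OF x, of "e / 3"] e by simp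
  then obtain W where W: "\<And>i. openin X (W i)" "\<And>i. x \<in> W i"
      "\<And>i y. y \<in> W i \<Longrightarrow> \<bar>g i y - g i x\<bar> < e / 3"
    by metis
  let ?V = "U \<inter> (\<Inter>i\<le>N. W i)"
  have "openin X ?V"
    using U W(1) by (intro openin_Int openin_INT2) auto
  moreover have "x \<in> ?V"
    using U W(2) by auto
  moreover have "\<bar>g i y - g i x\<bar> \<le> e" if y: "y \<in> ?V" for i y
  proof (cases "i \<le> N")
    case True
    then show ?thesis
      using W(3)[of y i] y e by force
  next
    case False
    have "\<bar>g N y - g N x\<bar> < e / 3"
      using W(3)[of y N] y by auto
    moreover have "\<bar>g i y - g N y\<bar> < e / 3" "\<bar>g i x - g N x\<bar> < e / 3"
      using N[of i N] False U y by auto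
    ultimately show ?thesis
      by linarith
  qed
  ultimately show "\<exists>V. openin X V \<and> x \<in> V \<and> (\<forall>i. \<forall>y\<in>V. \<bar>g i y - g i x\<bar> \<le> e)"
    by blast
qed

lemma equicontinuous_pointwise_limit:
  assumes eq: "equicontinuous X g"
    and lim: "\<And>x. x \<in> topspace X \<Longrightarrow> (\<lambda>n. g n x) \<longlonglongrightarrow> h x"
  shows "continuous_map X euclideanreal h"
  unfolding continuous_map_real_iff
proof (intro ballI allI impI)
  fix x and e :: real
  assume x: "x \<in> topspace X" and e: "e > 0"
  obtain U where U: "openin X U" "x \<in> U" "\<And>i y. y \<in> U \<Longrightarrow> \<bar>g i y - g i x\<bar> \<le> e / 2"
    using eq x e unfolding equicontinuous_def by (meson half_gt_zero)
  have "\<bar>h y - h x\<bar> < e" if y: "y \<in> U" for y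
  proof -
    have "y \<in> topspace X"
      using U(1) y openin_subset by blast
    then have "(\<lambda>n. \<bar>g n y - g n x\<bar>) \<longlonglongrightarrow> \<bar>h y - h x\<bar>"
      by (intro tendsto_intros lim x)
    then have "\<bar>h y - h x\<bar> \<le> e / 2"
      by (rule LIMSEQ_le_const2) (use U(3)[OF y] in auto)
    then show ?thesis
      using e by linarith
  qed
  then show "\<exists>U. openin X U \<and> x \<in> U \<and> (\<forall>y\<in>U. \<bar>h y - h x\<bar> < e)"
    using U by blast
qed

lemma equicontinuous_abs_diff:
  assumes g: "equicontinuous X g" and h: "continuous_map X euclideanreal h"
  shows "equicontinuous X (\<lambda>i x. \<bar>h x - g i x\<bar>)"
  unfolding equicontinuous_def
proof (intro ballI allI impI)
  fix x and e :: real
  assume x: "x \<in> topspace X" and "e > 0"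
  then have e: "e / 2 > 0"
    by simp
  obtain U where U: "openin X U" "x \<in> U" "\<And>i y. y \<in> U \<Longrightarrow> \<bar>g i y - g i x\<bar> \<le> e / 2"
    using g x e unfolding equicontinuous_def by meson
  obtain V where V: "openin X V" "x \<in> V" "\<And>y. y \<in> V \<Longrightarrow> \<bar>h y - h x\<bar> < e / 2"
    using h x e unfolding continuous_map_real_iff by meson
  have "\<bar>\<bar>h y - g i y\<bar> - \<bar>h x - g i x\<bar>\<bar> \<le> e" if "y \<in> U \<inter> V" for i y
    using U(3)[of y i] V(3)[of y] that unfolding Int_iff
    by (intro order_trans[OF abs_triangle_ineq3]) linarith
  then show "\<exists>U. openin X U \<and> x \<in> U \<and> (\<forall>i. \<forall>y\<in>U. \<bar>\<bar>h y - g i y\<bar> - \<bar>h x - g i x\<bar>\<bar> \<le> e)"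
    using U V by (intro exI[of _ "U \<inter> V"]) auto
qed

lemma cSUP_abs_diff_le:
  fixes u v :: "'i \<Rightarrow> real"
  assumes "A \<noteq> {}" "bdd_above (u ` A)" "bdd_above (v ` A)"
    and close: "\<And>i. i \<in> A \<Longrightarrow> \<bar>u i - v i\<bar> \<le> e"
  shows "\<bar>(SUP i\<in>A. u i) - (SUP i\<in>A. v i)\<bar> \<le> e"
proof -
  have "(SUP i\<in>A. u i) \<le> (SUP i\<in>A. v i) + e"
  proof (rule cSUP_least[OF assms(1)])
    fix i assume i: "i \<in> A"
    show "u i \<le> (SUP i\<in>A. v i) + e"
      using cSUP_upper[OF i assms(3)] close[OF i] by linarith
  qed
  moreover have "(SUP i\<in>A. v i) \<le> (SUP i\<in>A. u i) + e"
  proof (rule cSUP_least[OF assms(1)])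
    fix i assume i: "i \<in> A"
    show "v i \<le> (SUP i\<in>A. u i) + e"
      using cSUP_upper[OF i assms(2)] close[OF i] by linarith
  qed
  ultimately show ?thesis
    by linarith
qed

lemma equicontinuous_SUP:
  assumes d: "equicontinuous X d" and A: "A \<noteq> {}"
    and bdd: "\<And>x. x \<in> topspace X \<Longrightarrow> bdd_above ((\<lambda>i. d i x) ` A)"
  shows "continuous_map X euclideanreal (\<lambda>x. SUP i\<in>A. d i x)"
  unfolding continuous_map_real_iff
proof (intro ballI allI impI)
  fix x and e :: real
  assume x: "x \<in> topspace X" and e: "e > 0"
  obtain U where U: "openin X U" "x \<in> U" "\<And>i y. y \<in> U \<Longrightarrow> \<bar>d i y - d i x\<bar> \<le> e / 2"
    using d x e unfolding equicontinuous_def by (meson half_gt_zero)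
  have "\<bar>(SUP i\<in>A. d i y) - (SUP i\<in>A. d i x)\<bar> < e" if y: "y \<in> U" for y
  proof -
    have "y \<in> topspace X"
      using U(1) y openin_subset by blast
    then have "\<bar>(SUP i\<in>A. d i y) - (SUP i\<in>A. d i x)\<bar> \<le> e / 2"
      using U(3)[OF y] by (intro cSUP_abs_diff_le A bdd x) auto
    then show ?thesis
      using e by linarith
  qed
  then show "\<exists>U. openin X U \<and> x \<in> U \<and> (\<forall>y\<in>U. \<bar>(SUP i\<in>A. d i y) - (SUP i\<in>A. d i x)\<bar> < e)"
    using U by blast
qed

section \<open>Uniform convergence on compact sets\<close>

lemma cont_funs_fun_diff:
  "f \<in> cont_funs X \<Longrightarrow> g \<in> cont_funs X \<Longrightarrow> fun_diff X f g \<in> cont_funs X"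
  unfolding cont_funs_def fun_diff_def by (auto intro!: continuous_intros)

text \<open>
  The strict inequality in \<^term>\<open>ucc_ball X K e f\<close> does not visibly leave room for a ball around
  an arbitrary member; asking for a uniform gap below \<open>e\<close> gives a set that is open by the
  triangle inequality alone.
\<close>

lemma ucc_open_gap_ball:
  "ucc_open X {h \<in> cont_funs X. \<exists>d<e. \<forall>x\<in>K. \<bar>h x - f x\<bar> \<le> d}" if K: "compactin X K"
  unfolding ucc_open_def
proof (intro conjI ballI)
  fix h assume "h \<in> {h \<in> cont_funs X. \<exists>d<e. \<forall>x\<in>K. \<bar>h x - f x\<bar> \<le> d}"
  then obtain d where d: "d < e" "\<And>x. x \<in> K \<Longrightarrow> \<bar>h x - f x\<bar> \<le> d"
    by auto
  have "\<bar>k x - f x\<bar> \<le> (d + e) / 2" if "\<bar>k x - h x\<bar> < (e - d) / 2" "x \<in> K" for k x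
    using abs_triangle_ineq[of "k x - h x" "h x - f x"] d(2)[OF that(2)] that(1)
    by (simp add: field_simps)
  moreover have "(d + e) / 2 < e"
    using d(1) by simp
  ultimately have "ucc_ball X K ((e - d) / 2) h
      \<subseteq> {h \<in> cont_funs X. \<exists>d<e. \<forall>x\<in>K. \<bar>h x - f x\<bar> \<le> d}"
    unfolding ucc_ball_def by blast
  then show "\<exists>L r. compactin X L \<and> r > 0 \<and>
      ucc_ball X L r h \<subseteq> {h \<in> cont_funs X. \<exists>d<e. \<forall>x\<in>K. \<bar>h x - f x\<bar> \<le> d}"
    using K d(1) by (intro exI[of _ K] exI[of _ "(e - d) / 2"]) auto
qed auto

lemma ucc_Cauchy_iff_uniformly_Cauchy:
  assumes g: "\<And>n. g n \<in> cont_funs X"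
  shows "ucc_Cauchy X g \<longleftrightarrow>
    (\<forall>K. compactin X K \<longrightarrow> (\<forall>e>0. \<exists>N. \<forall>m\<ge>N. \<forall>n\<ge>N. \<forall>x\<in>K. \<bar>g m x - g n x\<bar> < e))"
    (is "?L \<longleftrightarrow> ?R")
proof
  assume L: ?L
  show ?R
  proof (intro allI impI)
    fix K and e :: real
    assume K: "compactin X K" and e: "e > 0"
    let ?U = "{h \<in> cont_funs X. \<exists>d<e. \<forall>x\<in>K. \<bar>h x - fun_zero X x\<bar> \<le> d}"
    have "fun_zero X \<in> ?U"
      using e by (auto simp: cont_funs_def fun_zero_def)
    then obtain N where N: "\<And>m n. \<lbrakk>m \<ge> N; n \<ge> N\<rbrakk> \<Longrightarrow> fun_diff X (g m) (g n) \<in> ?U"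
      using L ucc_open_gap_ball[OF K] unfolding ucc_Cauchy_def openin_ucc_topology by meson
    have "\<bar>g m x - g n x\<bar> < e" if "m \<ge> N" "n \<ge> N" "x \<in> K" for m n x
    proof -
      have "x \<in> topspace X"
        using K that(3) compactin_subset_topspace by blast
      then show ?thesis
        using N[OF that(1,2)] that(3) by (fastforce simp: fun_diff_def fun_zero_def)
    qed
    then show "\<exists>N. \<forall>m\<ge>N. \<forall>n\<ge>N. \<forall>x\<in>K. \<bar>g m x - g n x\<bar> < e"
      by blast
  qed
next
  assume R: ?R
  show ?L
    unfolding ucc_Cauchy_def openin_ucc_topology
  proof (intro conjI allI impI)
    fix U assume "ucc_open X U \<and> fun_zero X \<in> U"
    then obtain K e where K: "compactin X K" "e > 0" "ucc_ball X K e (fun_zero X) \<subseteq> U"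
      unfolding ucc_open_def by blast
    then obtain N where N: "\<And>m n x. \<lbrakk>m \<ge> N; n \<ge> N; x \<in> K\<rbrakk> \<Longrightarrow> \<bar>g m x - g n x\<bar> < e"
      using R by meson
    have "fun_diff X (g m) (g n) \<in> U" if "m \<ge> N" "n \<ge> N" for m n
      using N[OF that] K(3) cont_funs_fun_diff[OF g g] compactin_subset_topspace[OF K(1)]
      by (auto simp: ucc_ball_def fun_diff_def fun_zero_def subset_iff)
    then show "\<exists>N. \<forall>m\<ge>N. \<forall>n\<ge>N. fun_diff X (g m) (g n) \<in> U"
      by blast
  qed (rule g)
qed

lemma ucc_limit_of_uniformly_Cauchy:
  assumes g: "\<And>n. g n \<in> cont_funs X" and h: "h \<in> cont_funs X"
    and lim: "\<And>x. x \<in> topspace X \<Longrightarrow> (\<lambda>n. g n x) \<longlonglongrightarrow> h x"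
    and Cauchy: "ucc_Cauchy X g"
  shows "limitin (ucc_topology X) g h sequentially"
  unfolding limitin_sequentially topspace_ucc_topology openin_ucc_topology
proof (intro conjI allI impI h)
  fix U assume "ucc_open X U \<and> h \<in> U"
  then obtain K e where K: "compactin X K" and e: "e > 0" and U: "ucc_ball X K e h \<subseteq> U"
    unfolding ucc_open_def by blast
  obtain N where N: "\<And>m n x. \<lbrakk>m \<ge> N; n \<ge> N; x \<in> K\<rbrakk> \<Longrightarrow> \<bar>g m x - g n x\<bar> < e / 2"
    using Cauchy K e unfolding ucc_Cauchy_iff_uniformly_Cauchy[OF g] by (meson half_gt_zero)
  have "\<bar>g n x - h x\<bar> < e" if "n \<ge> N" "x \<in> K" for n x
  proof -
    have "(\<lambda>m. \<bar>g n x - g m x\<bar>) \<longlonglongrightarrow> \<bar>g n x - h x\<bar>"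
      using that(2) compactin_subset_topspace[OF K] by (intro tendsto_intros lim) auto
    then have "\<bar>g n x - h x\<bar> \<le> e / 2"
      by (rule LIMSEQ_le_const2) (use N[OF that(1) _ that(2)] less_imp_le in blast)
    then show ?thesis
      using e by linarith
  qed
  then show "\<exists>N. \<forall>n\<ge>N. g n \<in> U"
    using U g unfolding ucc_ball_def by blast
qed

section \<open>Pointwise infima and Dini's theorem\<close>

lemma pointwise_inf_zero_iff:
  assumes dec: "decreasing_in X I f"
  shows "pointwise_inf_zero X f \<longleftrightarrow>
    (\<forall>x\<in>topspace X. (\<forall>k. 0 \<le> f k x) \<and> (\<forall>e>0. \<exists>k. f k x < e))"
  unfolding pointwise_inf_zero_def
proof (intro ball_cong refl iffI conjI allI impI)
  fix x k
  assume "bdd_below (range (\<lambda>k. f k x)) \<and> (INF k. f k x) = 0"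
  then show "0 \<le> f k x"
    using cINF_lower[of "\<lambda>k. f k x" UNIV k] by simp
next
  fix x and e :: real
  assume "bdd_below (range (\<lambda>k. f k x)) \<and> (INF k. f k x) = 0" "e > 0"
  then show "\<exists>k. f k x < e"
    using cINF_less_iff[of UNIV "\<lambda>k. f k x" e] by simp
next
  fix x
  assume *: "(\<forall>k. 0 \<le> f k x) \<and> (\<forall>e>0. \<exists>k. f k x < e)"
  then show bdd: "bdd_below (range (\<lambda>k. f k x))"
    by (auto intro: bdd_belowI[of _ 0])
  show "(INF k. f k x) = 0"
  proof (rule antisym)
    show "(INF k. f k x) \<le> 0"
    proof (rule dense_ge)
      fix e :: real assume "0 < e"
      then obtain k where "f k x < e"
        using * by blast
      then show "(INF k. f k x) \<le> e"
        using cINF_lower[OF bdd UNIV_I, of k] by linarith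
    qed
    show "0 \<le> (INF k. f k x)"
      using * by (intro cINF_greatest) auto
  qed
qed

text \<open>
  The open sets \<open>{x. f k x < e}\<close> increase with \<open>k\<close> and cover, so a single one of them
  contains the compact set.
\<close>

lemma Dini_compactin:
  assumes dec: "decreasing_in X I f" and inf: "pointwise_inf_zero X f"
    and I: "I \<subseteq> cont_funs X" and K: "compactin X K" and e: "e > 0"
  shows "\<exists>k. \<forall>x\<in>K. f k x < e"
proof -
  let ?U = "\<lambda>k. {x \<in> topspace X. f k x < e}"
  have cont: "continuous_map X euclideanreal (f k)" for k
    using dec I unfolding decreasing_in_def cont_funs_def by blast
  have "openin X (?U k)" for k
    using openin_continuous_map_preimage[OF cont, of "{..<e}"] by simp
  moreover have "K \<subseteq> \<Union>(range ?U)"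
  proof
    fix x assume "x \<in> K"
    then have x: "x \<in> topspace X"
      using compactin_subset_topspace[OF K] by blast
    then obtain k where "f k x < e"
      using inf e unfolding pointwise_inf_zero_iff[OF dec] by metis
    with x show "x \<in> \<Union>(range ?U)"
      by blast
  qed
  moreover have "\<forall>\<U>. (\<forall>U\<in>\<U>. openin X U) \<and> K \<subseteq> \<Union>\<U> \<longrightarrow>
      (\<exists>\<F>. finite \<F> \<and> \<F> \<subseteq> \<U> \<and> K \<subseteq> \<Union>\<F>)"
    using K unfolding compactin_def by (rule conjunct2)
  ultimately obtain \<F> where \<F>: "finite \<F>" "\<F> \<subseteq> range ?U" "K \<subseteq> \<Union>\<F>"
    by (elim allE[of _ "range ?U"] impE exE conjE) auto
  obtain S where S: "finite S" "\<F> = ?U ` S"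
    using finite_subset_image[OF \<F>(1,2)] by blast
  have "f (Max S) x < e" if x: "x \<in> K" for x
  proof -
    obtain k where "k \<in> S" "x \<in> topspace X" "f k x < e"
      using \<F>(3) S(2) x by blast
    moreover have "f (Max S) x \<le> f k x"
      using dec calculation Max_ge[OF S(1)] unfolding decreasing_in_def fun_le_def by blast
    ultimately show ?thesis
      by linarith
  qed
  then show ?thesis
    by blast
qed

section \<open>Riesz ideals\<close>

lemma riesz_ideal_cont_funs: "riesz_ideal X I \<Longrightarrow> I \<subseteq> cont_funs X"
  by (simp add: riesz_ideal_def)

lemma positive_partD: "b \<in> positive_part X I \<Longrightarrow> b \<in> I"
  by (simp add: positive_part_def)

lemma riesz_ideal_solid:
  assumes I: "riesz_ideal X I" and b: "b \<in> I"
    and f: "continuous_map X euclideanreal f" "f \<in> extensional (topspace X)"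
    and le: "\<And>x. x \<in> topspace X \<Longrightarrow> \<bar>f x\<bar> \<le> \<bar>b x\<bar>"
  shows "f \<in> I"
proof -
  have "f \<in> cont_funs X" "fun_le X (fun_abs X f) (fun_abs X b)"
    using f le by (auto simp: cont_funs_def fun_le_def fun_abs_def)
  then show ?thesis
    using I b unfolding riesz_ideal_def by blast
qed

lemma riesz_ideal_fun_abs:
  assumes I: "riesz_ideal X I" and f: "f \<in> I"
  shows "fun_abs X f \<in> I"
proof (rule riesz_ideal_solid[OF I f])
  have "continuous_map X euclideanreal f"
    using I f unfolding riesz_ideal_def cont_funs_def by blast
  then show "continuous_map X euclideanreal (fun_abs X f)"
    unfolding fun_abs_def by (auto intro!: continuous_intros)
qed (auto simp: fun_abs_def)

lemma riesz_ideal_finite_bound: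
  fixes g :: "nat \<Rightarrow> 'a \<Rightarrow> real"
  assumes I: "riesz_ideal X I" and g: "\<And>n. g n \<in> I"
  shows "\<exists>b\<in>I. \<forall>x\<in>topspace X. 0 \<le> b x \<and> (\<forall>n<N. \<bar>g n x\<bar> \<le> b x)"
proof (induction N)
  case 0
  have "fun_zero X \<in> I"
    using I unfolding riesz_ideal_def by blast
  then show ?case
    by (intro bexI[of _ "fun_zero X"]) (auto simp: fun_zero_def)
next
  case (Suc N)
  then obtain b where b: "b \<in> I" "\<And>x. x \<in> topspace X \<Longrightarrow> 0 \<le> b x"
      "\<And>x n. x \<in> topspace X \<Longrightarrow> n < N \<Longrightarrow> \<bar>g n x\<bar> \<le> b x"
    by blast
  have "fun_add X b (fun_abs X (g N)) \<in> I"
    using I b(1) riesz_ideal_fun_abs[OF I g] unfolding riesz_ideal_def by blast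
  moreover have "\<bar>g n x\<bar> \<le> b x + \<bar>g N x\<bar>" if "x \<in> topspace X" "n < Suc N" for n x
    using b(2,3)[OF that(1)] that(2) by (cases "n = N") (auto intro: add_increasing2)
  ultimately show ?case
    using b(2) by (intro bexI[of _ "fun_add X b (fun_abs X (g N))"])
      (auto simp: fun_add_def fun_abs_def)
qed

section \<open>Strict Cauchy sequences\<close>

lemma strictly_CauchyE:
  assumes "strictly_Cauchy X I g"
  obtains f where "decreasing_in X I f" "pointwise_inf_zero X f"
    "\<And>k. \<exists>N. \<forall>n\<ge>N. \<forall>x\<in>topspace X. \<bar>g n x - g N x\<bar> \<le> f k x"
proof -
  obtain f where "decreasing_in X I f" "pointwise_inf_zero X f"
    and "\<forall>k. \<exists>N. \<forall>n\<ge>N. fun_le X (fun_abs X (fun_diff X (g n) (g N))) (f k)"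
    using assms unfolding strictly_Cauchy_def by blast
  then show thesis
    by (intro that[of f]) (simp_all add: fun_le_def fun_abs_def fun_diff_def)
qed

lemma strictly_Cauchy_order_bounded:
  assumes I: "riesz_ideal X I" and Cauchy: "strictly_Cauchy X I g"
  shows "\<exists>b\<in>positive_part X I. \<forall>n. fun_le X (fun_abs X (g n)) b"
proof -
  have g: "\<And>n. g n \<in> I"
    using Cauchy unfolding strictly_Cauchy_def by blast
  obtain f where dec: "decreasing_in X I f" and inf: "pointwise_inf_zero X f"
    and f: "\<And>k. \<exists>N. \<forall>n\<ge>N. \<forall>x\<in>topspace X. \<bar>g n x - g N x\<bar> \<le> f k x"
    using strictly_CauchyE[OF Cauchy] by blast
  obtain N where N: "\<And>n x. \<lbrakk>n \<ge> N; x \<in> topspace X\<rbrakk> \<Longrightarrow> \<bar>g n x - g N x\<bar> \<le> f 0 x"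
    using f by blast
  have f0: "\<And>x. x \<in> topspace X \<Longrightarrow> 0 \<le> f 0 x"
    using inf unfolding pointwise_inf_zero_iff[OF dec] by blast
  obtain b where b: "b \<in> I" "\<And>x. x \<in> topspace X \<Longrightarrow> 0 \<le> b x"
      "\<And>x n. x \<in> topspace X \<Longrightarrow> n < Suc N \<Longrightarrow> \<bar>g n x\<bar> \<le> b x"
    using riesz_ideal_finite_bound[where g = g and N = "Suc N", OF I g] by blast
  have "fun_add X b (f 0) \<in> I"
    using I b(1) dec unfolding riesz_ideal_def decreasing_in_def by blast
  then have "fun_add X b (f 0) \<in> positive_part X I"
    using b(2) f0 by (auto simp: positive_part_def fun_le_def fun_zero_def fun_add_def)
  moreover have "\<bar>g n x\<bar> \<le> b x + f 0 x" if x: "x \<in> topspace X" for n x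
  proof (cases "n < Suc N")
    case True
    then show ?thesis
      using b(3)[OF x] f0[OF x] by fastforce
  next
    case False
    then show ?thesis
      using N[of n x] b(3)[OF x, of N] x by fastforce
  qed
  ultimately show ?thesis
    by (intro bexI[of _ "fun_add X b (f 0)"]) (auto simp: fun_le_def fun_abs_def fun_add_def)
qed

lemma strictly_Cauchy_imp_ucc_Cauchy:
  assumes I: "I \<subseteq> cont_funs X" and Cauchy: "strictly_Cauchy X I g"
  shows "ucc_Cauchy X g"
proof -
  have g: "g n \<in> cont_funs X" for n
    using I Cauchy unfolding strictly_Cauchy_def by blast
  obtain f where dec: "decreasing_in X I f" and inf: "pointwise_inf_zero X f"
    and f: "\<And>k. \<exists>N. \<forall>n\<ge>N. \<forall>x\<in>topspace X. \<bar>g n x - g N x\<bar> \<le> f k x"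
    using strictly_CauchyE[OF Cauchy] by blast
  show ?thesis
    unfolding ucc_Cauchy_iff_uniformly_Cauchy[OF g]
  proof (intro allI impI)
    fix K and e :: real
    assume K: "compactin X K" and "e > 0"
    then obtain k where k: "\<And>x. x \<in> K \<Longrightarrow> f k x < e / 2"
      using Dini_compactin[OF dec inf I K, of "e / 2"] by auto
    obtain N where N: "\<And>n x. \<lbrakk>n \<ge> N; x \<in> topspace X\<rbrakk> \<Longrightarrow> \<bar>g n x - g N x\<bar> \<le> f k x"
      using f by blast
    have "\<bar>g m x - g n x\<bar> < e" if "m \<ge> N" "n \<ge> N" "x \<in> K" for m n x
    proof -
      have "x \<in> topspace X"
        using K that(3) compactin_subset_topspace by blast
      then show ?thesis
        using N[of m x] N[of n x] k[of x] that by linarith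
    qed
    then show "\<exists>N. \<forall>m\<ge>N. \<forall>n\<ge>N. \<forall>x\<in>K. \<bar>g m x - g n x\<bar> < e"
      by blast
  qed
qed

lemma strictly_convergent_imp_strictly_Cauchy:
  assumes I: "riesz_ideal X I" and conv: "strictly_convergent X I g h"
  shows "strictly_Cauchy X I g"
proof -
  obtain p where dec: "decreasing_in X I p" and inf: "pointwise_inf_zero X p"
    and "\<forall>k. \<exists>N. \<forall>n\<ge>N. fun_le X (fun_abs X (fun_diff X h (g n))) (p k)"
    using conv unfolding strictly_convergent_def by (elim conjE exE)
  then have p: "\<exists>N. \<forall>n\<ge>N. \<forall>x\<in>topspace X. \<bar>h x - g n x\<bar> \<le> p k x" for k
    by (simp add: fun_le_def fun_abs_def fun_diff_def)
  let ?f = "\<lambda>k. fun_scale X 2 (p k)"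
  have dec': "decreasing_in X I ?f"
    using dec I unfolding decreasing_in_def riesz_ideal_def
    by (auto simp: fun_le_def fun_scale_def)
  have "\<exists>k. 2 * p k x < e" if x: "x \<in> topspace X" and e: "e > 0" for x e
  proof -
    obtain k where "p k x < e / 2"
      using inf x e unfolding pointwise_inf_zero_iff[OF dec] by (meson half_gt_zero)
    then show ?thesis
      by (intro exI[of _ k]) simp
  qed
  then have "pointwise_inf_zero X ?f"
    using inf unfolding pointwise_inf_zero_iff[OF dec] pointwise_inf_zero_iff[OF dec']
    by (simp add: fun_scale_def)
  moreover have "\<exists>N. \<forall>n\<ge>N. fun_le X (fun_abs X (fun_diff X (g n) (g N))) (?f k)" for k
  proof -
    obtain N where N: "\<And>n x. \<lbrakk>n \<ge> N; x \<in> topspace X\<rbrakk> \<Longrightarrow> \<bar>h x - g n x\<bar> \<le> p k x"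
      using p by blast
    have "\<bar>g n x - g N x\<bar> \<le> 2 * p k x" if "n \<ge> N" "x \<in> topspace X" for n x
      using N[OF that] N[OF order_refl that(2)] by linarith
    then show ?thesis
      by (auto simp: fun_le_def fun_abs_def fun_diff_def fun_scale_def)
  qed
  ultimately show ?thesis
    using conv dec' unfolding strictly_Cauchy_def strictly_convergent_def by blast
qed

text \<open>
  The dominating sequence consists of the tail suprema of \<open>\<bar>h - g m\<bar>\<close>; each index is its
  own threshold.
\<close>

lemma order_bounded_ucc_Cauchy_convergent:
  assumes lc: "locally_compact_space X" and I: "riesz_ideal X I"
    and g: "\<And>n. g n \<in> I"
    and b: "b \<in> I" and bound: "\<And>n. fun_le X (fun_abs X (g n)) b"
    and Cauchy: "ucc_Cauchy X g"
  shows "\<exists>h\<in>I. limitin (ucc_topology X) g h sequentially \<and> strictly_convergent X I g h"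
proof -
  have gb: "\<bar>g n x\<bar> \<le> b x" if "x \<in> topspace X" for n x
    using bound that by (auto simp: fun_le_def fun_abs_def)
  have gC: "g n \<in> cont_funs X" for n
    using I g unfolding riesz_ideal_def by blast
  have unif: "\<exists>N. \<forall>m\<ge>N. \<forall>n\<ge>N. \<forall>x\<in>K. \<bar>g m x - g n x\<bar> < e"
    if "compactin X K" "e > 0" for K e
    using Cauchy that unfolding ucc_Cauchy_iff_uniformly_Cauchy[OF gC] by blast
  have "equicontinuous X g"
  proof (rule locally_uniformly_Cauchy_equicontinuous)
    show "continuous_map X euclideanreal (g n)" for n
      using gC unfolding cont_funs_def by blast
    show "\<exists>U. openin X U \<and> x \<in> U \<and>
        (\<forall>e>0. \<exists>N. \<forall>m\<ge>N. \<forall>n\<ge>N. \<forall>y\<in>U. \<bar>g m y - g n y\<bar> < e)" if x: "x \<in> topspace X" for x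
    proof -
      obtain U K where U: "openin X U" "x \<in> U" and K: "compactin X K" "U \<subseteq> K"
        using lc x unfolding locally_compact_space_def by blast
      have "\<exists>N. \<forall>m\<ge>N. \<forall>n\<ge>N. \<forall>y\<in>U. \<bar>g m y - g n y\<bar> < e" if e: "e > 0" for e
        using unif[OF K(1) e] K(2) by blast
      with U show ?thesis
        by (intro exI[of _ U]) simp
    qed
  qed
  have "convergent (\<lambda>n. g n x)" if "x \<in> topspace X" for x
    using unif[of "{x}"] that
    by (intro Cauchy_convergent) (simp add: Cauchy_def dist_real_def)
  then have lim_ex: "\<exists>l. (\<lambda>n. g n x) \<longlonglongrightarrow> l" if "x \<in> topspace X" for x
    using that by (simp add: convergent_def)
  define h where "h = (\<lambda>x\<in>topspace X. lim (\<lambda>n. g n x))"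
  have lim: "(\<lambda>n. g n x) \<longlonglongrightarrow> h x" if "x \<in> topspace X" for x
    using lim_ex[OF that] that limI by (fastforce simp: h_def)
  have hcont: "continuous_map X euclideanreal h"
    using \<open>equicontinuous X g\<close> lim by (rule equicontinuous_pointwise_limit)
  have hb: "\<bar>h x\<bar> \<le> b x" if "x \<in> topspace X" for x
    using LIMSEQ_le_const2[OF tendsto_rabs[OF lim[OF that]]] gb[OF that] by blast
  have hI: "h \<in> I"
    by (rule riesz_ideal_solid[OF I b hcont]) (use hb in \<open>force simp: h_def\<close>)+
  have hC: "h \<in> cont_funs X"
    using I hI unfolding riesz_ideal_def by blast

  have diff_le: "\<bar>h x - g m x\<bar> \<le> 2 * b x" if "x \<in> topspace X" for m x
    using hb[OF that] gb[OF that, of m] by linarith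
  then have bdd: "bdd_above ((\<lambda>m. \<bar>h x - g m x\<bar>) ` A)" if "x \<in> topspace X" for A x
    using that by (auto intro: bdd_aboveI[of _ "2 * b x"])
  define p where "p n = (\<lambda>x\<in>topspace X. SUP m\<in>{n..}. \<bar>h x - g m x\<bar>)" for n
  have p_ge: "\<bar>h x - g m x\<bar> \<le> p n x" if "n \<le> m" "x \<in> topspace X" for n m x
    using cSUP_upper[OF _ bdd[OF that(2)], of m "{n..}"] that by (simp add: p_def)
  have p_le: "p n x \<le> c" if "x \<in> topspace X" "\<And>m. n \<le> m \<Longrightarrow> \<bar>h x - g m x\<bar> \<le> c" for n x c
    using that by (auto simp: p_def intro: cSUP_least)
  have p_nonneg: "0 \<le> p n x" if "x \<in> topspace X" for n x
    using p_ge[OF order_refl that, of n] by linarith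
  have d: "equicontinuous X (\<lambda>m x. \<bar>h x - g m x\<bar>)"
    using \<open>equicontinuous X g\<close> hcont by (rule equicontinuous_abs_diff)
  have b2: "fun_scale X 2 b \<in> I"
    using I b unfolding riesz_ideal_def by blast
  have pI: "p n \<in> I" for n
  proof (rule riesz_ideal_solid[OF I b2])
    have "continuous_map X euclideanreal (\<lambda>x. SUP m\<in>{n..}. \<bar>h x - g m x\<bar>)"
      using d by (rule equicontinuous_SUP) (simp_all add: bdd)
    then show "continuous_map X euclideanreal (p n)"
      unfolding p_def by simp
    show "\<bar>p n x\<bar> \<le> \<bar>fun_scale X 2 b x\<bar>" if "x \<in> topspace X" for x
      using p_nonneg[OF that, of n] p_le[OF that diff_le[OF that], of n] that
      by (simp add: fun_scale_def)
  qed (simp add: p_def)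
  have dec: "decreasing_in X I p"
    unfolding decreasing_in_def fun_le_def
  proof (intro conjI allI impI ballI pI)
    fix j k :: nat and x assume "j \<le> k" "x \<in> topspace X"
    then show "p k x \<le> p j x"
      by (intro p_le p_ge) auto
  qed
  have "\<exists>k. p k x < e" if x: "x \<in> topspace X" and e: "e > 0" for x e
  proof -
    obtain k where k: "\<And>m. m \<ge> k \<Longrightarrow> \<bar>g m x - h x\<bar> < e / 2"
      using LIMSEQ_D[OF lim[OF x], of "e / 2"] e by auto
    have "p k x \<le> e / 2"
      by (rule p_le[OF x]) (use k in \<open>simp add: abs_minus_commute less_imp_le\<close>)
    then show ?thesis
      using e by (intro exI[of _ k]) linarith
  qed
  then have "pointwise_inf_zero X p"
    using p_nonneg unfolding pointwise_inf_zero_iff[OF dec] by blast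
  moreover have "\<forall>n\<ge>k. fun_le X (fun_abs X (fun_diff X h (g n))) (p k)" for k
    using p_ge by (auto simp: fun_le_def fun_abs_def fun_diff_def)
  ultimately have "strictly_convergent X I g h"
    using g hI dec unfolding strictly_convergent_def by blast
  then show ?thesis
    using hI ucc_limit_of_uniformly_Cauchy[OF gC hC lim Cauchy] by blast
qed

theorem proposition3p7:
  fixes X :: "'a topology" and I :: "('a \<Rightarrow> real) set" and g :: "nat \<Rightarrow> 'a \<Rightarrow> real"
  assumes "topspace X \<noteq> {}"
    and "Lindelof_space X"
    and "locally_compact_space X"
    and "Hausdorff_space X"
    and "riesz_ideal X I"
    and "\<And>n. g n \<in> I"
  shows "(strictly_Cauchy X I g \<longleftrightarrow>
            (\<exists>b\<in>positive_part X I. \<forall>n. fun_le X (fun_abs X (g n)) b) \<and> ucc_Cauchy X g) \<and>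
         (strictly_Cauchy X I g \<or>
            ((\<exists>b\<in>positive_part X I. \<forall>n. fun_le X (fun_abs X (g n)) b) \<and> ucc_Cauchy X g) \<longrightarrow>
          (\<exists>h\<in>I. limitin (ucc_topology X) g h sequentially \<and> strictly_convergent X I g h))"
  using strictly_Cauchy_order_bounded[OF assms(5), of g]
    strictly_Cauchy_imp_ucc_Cauchy[OF riesz_ideal_cont_funs[OF assms(5)], of g]
    order_bounded_ucc_Cauchy_convergent[where g = g, OF assms(3,5,6)] positive_partD[of _ X I]
    strictly_convergent_imp_strictly_Cauchy[OF assms(5), of g]
  by meson

end
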